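(* For every $\epsilon>0$ there is $n_0$ such that for every $n>n_0$, $irr(n)\ge n^{2-\epsilon}$.
   Context: A hypergraph $H=(V,E)$ has a finite vertex set $V$ and a set $E$ of subsets of $V$ (hyperedges). An edge-labeling $g:E\to\{1,2,\dots\}$ is irregular if the sums $\sigma(x)=\sum_{e\in E,\, e\ni x}g(e)$, $x\in V$, are pairwise distinct. $irr(H)$ is the smallest possible value of the largest label in an irregular labeling of $H$, and $irr(n)$ is the largest value of $irr(H)$ over all $n$-vertex hypergraphs $H$ (admitting an irregular labeling). *)

theory Defs
  imports Complex_Main
begin

definition hypergraph :: "'a set \<Rightarrow> 'a set set \<Rightarrow> bool" where
  "hypergraph V E \<longleftrightarrow> finite V \<and> E \<subseteq> Pow V"

definition vertex_sum :: "'a set set \<Rightarrow> ('a set \<Rightarrow> nat) \<Rightarrow> 'a \<Rightarrow> nat" where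
  "vertex_sum E g x = (\<Sum>e\<in>{e \<in> E. x \<in> e}. g e)"

definition irregular_labeling :: "'a set \<Rightarrow> 'a set set \<Rightarrow> ('a set \<Rightarrow> nat) \<Rightarrow> bool" where
  "irregular_labeling V E g \<longleftrightarrow> (\<forall>e\<in>E. 1 \<le> g e) \<and> inj_on (vertex_sum E g) V"

text \<open>
  Inserting 0 only matters when there are no edges: the largest label is then 0
  instead of being unspecified.
\<close>

definition largest_label :: "'a set set \<Rightarrow> ('a set \<Rightarrow> nat) \<Rightarrow> nat" where
  "largest_label E g = Max (insert 0 (g ` E))"

text \<open>Meaningful only if an irregular labeling exists.\<close>

definition irr :: "'a set \<Rightarrow> 'a set set \<Rightarrow> nat" where
  "irr V E = (LEAST k. \<exists>g. irregular_labeling V E g \<and> k = largest_label E g)"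

definition irr_values :: "nat \<Rightarrow> nat set" where
  "irr_values n =
    {irr V E | (V :: nat set) E. hypergraph V E \<and> card V = n \<and> (\<exists>g. irregular_labeling V E g)}"

text \<open>
  Taking the vertices to be natural numbers loses no generality, and the maximum ranges over
  a finite nonempty set; both facts are proved below (\<open>irr_le_irr_max\<close>,
  \<open>finite_irr_values\<close>, \<open>irr_values_nonempty\<close>).
\<close>

definition irr_max :: "nat \<Rightarrow> nat" where
  "irr_max n = Max (irr_values n)"

lemma irr_valuesI:
  fixes V :: "nat set"
  assumes "hypergraph V E" "card V = n" "irregular_labeling V E g"
  shows "irr V E \<in> irr_values n"
  using assms unfolding irr_values_def by blast

lemma vertex_sum_image:
  assumes "inj_on f V" "E \<subseteq> Pow V" "x \<in> V"
  shows "vertex_sum ((`) f ` E) g (f x) = vertex_sum E (\<lambda>e. g (f ` e)) x"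
proof -
  have inj: "inj_on ((`) f) {e \<in> E. x \<in> e}"
    using assms(1,2) by (intro inj_on_subset[OF inj_on_image_Pow]) auto
  have "f x \<in> f ` e \<longleftrightarrow> x \<in> e" if "e \<in> E" for e
    using assms that by (intro inj_on_image_mem_iff) auto
  then have "{e \<in> (`) f ` E. f x \<in> e} = (`) f ` {e \<in> E. x \<in> e}"
    by auto
  then show ?thesis
    unfolding vertex_sum_def by (simp add: sum.reindex[OF inj])
qed

lemma irregular_labeling_image:
  assumes "inj_on f V" "E \<subseteq> Pow V"
  shows "irregular_labeling (f ` V) ((`) f ` E) g \<longleftrightarrow>
    irregular_labeling V E (\<lambda>e. g (f ` e))"
proof -
  have "inj_on (vertex_sum ((`) f ` E) g) (f ` V) \<longleftrightarrow>
      inj_on (vertex_sum ((`) f ` E) g \<circ> f) V"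
    using assms(1) comp_inj_on inj_on_imageI by blast
  also have "\<dots> \<longleftrightarrow> inj_on (vertex_sum E (\<lambda>e. g (f ` e))) V"
    by (intro inj_on_cong) (simp add: vertex_sum_image[OF assms])
  finally show ?thesis
    by (simp add: irregular_labeling_def)
qed

lemma irregular_labeling_cong:
  assumes "\<And>e. e \<in> E \<Longrightarrow> g e = h e"
  shows "irregular_labeling V E g \<longleftrightarrow> irregular_labeling V E h"
proof -
  have "vertex_sum E g = vertex_sum E h"
    unfolding vertex_sum_def by (intro ext sum.cong) (auto simp: assms)
  then show ?thesis
    by (simp add: irregular_labeling_def assms)
qed

lemma largest_label_image:
  "largest_label ((`) f ` E) g = largest_label E (\<lambda>e. g (f ` e))"
  by (simp add: largest_label_def image_image)

lemma largest_label_cong: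
  assumes "\<And>e. e \<in> E \<Longrightarrow> g e = h e"
  shows "largest_label E g = largest_label E h"
  by (simp add: largest_label_def assms cong: image_cong_simp)

lemma irregular_transfer:
  assumes "inj_on f V" "E \<subseteq> Pow V"
  shows "(\<exists>g. irregular_labeling (f ` V) ((`) f ` E) g \<and> k = largest_label ((`) f ` E) g) \<longleftrightarrow>
    (\<exists>g. irregular_labeling V E g \<and> k = largest_label E g)" (is "?L \<longleftrightarrow> ?R")
proof
  assume ?L
  then show ?R
    using irregular_labeling_image[OF assms] largest_label_image by blast
next
  assume ?R
  then obtain g where g: "irregular_labeling V E g" "k = largest_label E g"
    by blast
  define h where "h = (\<lambda>e. g (inv_into V f ` e))"
  have h: "g e = h (f ` e)" if "e \<in> E" for e
  proof -
    have "e \<subseteq> V" using that assms(2) by auto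
    then show ?thesis
      by (simp add: h_def inv_into_image_cancel[OF assms(1)])
  qed
  have "irregular_labeling (f ` V) ((`) f ` E) h"
    using g(1) irregular_labeling_cong[of E g "\<lambda>e. h (f ` e)" V, OF h]
    by (simp add: irregular_labeling_image[OF assms])
  moreover have "k = largest_label ((`) f ` E) h"
    using g(2) largest_label_cong[of E g "\<lambda>e. h (f ` e)", OF h]
    by (simp add: largest_label_image)
  ultimately show ?L by blast
qed

lemma irr_image:
  assumes "inj_on f V" "E \<subseteq> Pow V"
  shows "irr (f ` V) ((`) f ` E) = irr V E"
  unfolding irr_def by (simp only: irregular_transfer[OF assms])

lemma irr_relabel:
  assumes "hypergraph V E" "irregular_labeling V E g"
  obtains F where "hypergraph {..<card V} F" "irr {..<card V} F = irr V E"
    "\<exists>h. irregular_labeling {..<card V} F h"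
proof -
  have fin: "finite V" and E: "E \<subseteq> Pow V"
    using assms(1) by (auto simp: hypergraph_def)
  obtain f where f: "bij_betw f V {..<card V}"
    using ex_bij_betw_finite_nat[OF fin] by (auto simp: atLeast0LessThan)
  then have inj: "inj_on f V" and img: "f ` V = {..<card V}"
    by (auto simp: bij_betw_def)
  show ?thesis
  proof (rule that[of "(`) f ` E"])
    show "hypergraph {..<card V} ((`) f ` E)"
      using E unfolding hypergraph_def img[symmetric] using fin by auto
    show "irr {..<card V} ((`) f ` E) = irr V E"
      using irr_image[OF inj E] by (simp add: img)
    show "\<exists>h. irregular_labeling {..<card V} ((`) f ` E) h"
      using irregular_transfer[OF inj E, of "largest_label E g"] assms(2) unfolding img by blast
  qed
qed

lemma finite_irr_values: "finite (irr_values n)"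
proof (rule finite_subset)
  show "irr_values n \<subseteq> irr {..<n} ` Pow (Pow {..<n})"
  proof
    fix k assume "k \<in> irr_values n"
    then obtain V :: "nat set" and E g where H: "hypergraph V E" "card V = n"
        "irregular_labeling V E g" "k = irr V E"
      unfolding irr_values_def by blast
    obtain F where "hypergraph {..<card V} F" "irr {..<card V} F = irr V E"
      using irr_relabel[OF H(1,3)] by blast
    then have "F \<in> Pow (Pow {..<n})" "k = irr {..<n} F"
      using H by (simp_all add: hypergraph_def)
    then show "k \<in> irr {..<n} ` Pow (Pow {..<n})"
      by blast
  qed
qed simp

lemma irr_le_irr_max:
  fixes V :: "'a set"
  assumes "hypergraph V E" "irregular_labeling V E g"
  shows "irr V E \<le> irr_max (card V)"
proof -
  obtain F where F: "hypergraph {..<card V} F" "irr {..<card V} F = irr V E"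
    "\<exists>h. irregular_labeling {..<card V} F h"
    using irr_relabel[OF assms] by blast
  obtain h where "irregular_labeling {..<card V} F h"
    using F(3) by blast
  then have "irr V E \<in> irr_values (card V)"
    using irr_valuesI[OF F(1) card_lessThan] unfolding F(2) by blast
  then show ?thesis
    unfolding irr_max_def by (rule Max_ge[OF finite_irr_values])
qed

lemma irr_values_nonempty: "irr_values n \<noteq> {}"
proof -
  define E where "E = (\<lambda>i. {i}) ` {..<n}"
  define g where "g = (\<lambda>e :: nat set. Suc (Min e))"
  have "vertex_sum E g i = Suc i" if "i < n" for i
  proof -
    have "{e \<in> E. i \<in> e} = {{i}}"
      using that by (auto simp: E_def)
    then show ?thesis
      by (simp add: vertex_sum_def g_def)
  qed
  then have "irregular_labeling {..<n} E g"
    by (auto simp: irregular_labeling_def g_def inj_on_def)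
  moreover have "hypergraph {..<n} E"
    by (auto simp: hypergraph_def E_def)
  ultimately have "irr {..<n} E \<in> irr_values n"
    by (intro irr_valuesI) auto
  then show ?thesis
    by blast
qed

end

theory Submission
  imports Defs "HOL-Library.FuncSet" "HOL-Library.Nat_Bijection" "HOL-Real_Asymp.Real_Asymp"
begin

text \<open>
  Take as vertices a random family \<open>S\<close> of \<open>n\<close> subsets of \<open>{..<m}\<close>, where \<open>m\<close> is of order \<open>ln n\<close>,
  and as edges the \<open>m\<close> sets \<open>{v \<in> S. i \<in> v}\<close>. With labels at most \<open>k\<close> the vertex sums take at most
  \<open>N = m * k + 1\<close> values, so by the birthday paradox a fixed labeling is irregular with probability
  about \<open>exp (- n\<^sup>2 / (2 * N))\<close> at most. For \<open>k\<close> about \<open>n powr (2 - \<epsilon>)\<close> this is superpolynomially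
  smaller than \<open>1 / (k + 1) ^ m\<close>, and a union bound over all labelings gives an \<open>S\<close> for which none
  of them is irregular.
\<close>

section \<open>Counting the subsets on which a fixed map is injective\<close>

text \<open>This is AM-GM for the factors \<open>1 + u t\<close>, whose mean is
  \<open>1 + y\<close>. Bounding \<open>(1 + u t) / (1 + y)\<close> by
  \<open>exp ((u t - y) / (1 + y))\<close> proves it, since these exponents sum to 0.\<close>

lemma prod_one_plus_le:
  fixes u :: "'a \<Rightarrow> real" and y :: real
  assumes "finite T" "\<And>t. t \<in> T \<Longrightarrow> 0 \<le> u t" "0 \<le> y" "(\<Sum>t\<in>T. u t) = card T * y"
  shows "(\<Prod>t\<in>T. 1 + u t) \<le> (1 + y) ^ card T"
proof -
  have "1 + u t \<le> (1 + y) * exp ((u t - y) / (1 + y))" for t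
  proof -
    have "(1 + u t) / (1 + y) = 1 + (u t - y) / (1 + y)"
      using assms(3) by (simp add: field_simps)
    also have "\<dots> \<le> exp ((u t - y) / (1 + y))"
      by (rule exp_ge_add_one_self)
    finally show ?thesis
      using assms(3) by (simp add: field_simps)
  qed
  then have "(\<Prod>t\<in>T. 1 + u t) \<le> (\<Prod>t\<in>T. (1 + y) * exp ((u t - y) / (1 + y)))"
    using assms(2) by (intro prod_mono) (auto intro: add_nonneg_nonneg)
  also have "\<dots> = (1 + y) ^ card T * exp (\<Sum>t\<in>T. (u t - y) / (1 + y))"
    by (simp add: prod.distrib exp_sum assms(1))
  also have "(\<Sum>t\<in>T. (u t - y) / (1 + y)) = 0"
    using assms(4) by (simp add: sum_divide_distrib[symmetric] sum_subtractf)
  finally show ?thesis by simp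
qed

text \<open>A set \<open>S\<close> on which \<open>f\<close> is injective is determined by its image
  \<open>I\<close> and the function picking, for each \<open>t\<close> in \<open>I\<close>, the
  element of \<open>S\<close> in the fibre over \<open>t\<close>. The map \<open>h\<close> records
  this pair.\<close>

lemma card_inj_subsets_le_sum_prod:
  assumes "finite X" "finite T" "f ` X \<subseteq> T"
  shows "card {S. S \<subseteq> X \<and> card S = n \<and> inj_on f S}
    \<le> (\<Sum>I | I \<subseteq> T \<and> card I = n. \<Prod>t\<in>I. card {v \<in> X. f v = t})"
proof -
  let ?\<S> = "{S. S \<subseteq> X \<and> card S = n \<and> inj_on f S}" and ?\<I> = "{I. I \<subseteq> T \<and> card I = n}"
  let ?P = "\<lambda>I. PiE I (\<lambda>t. {v \<in> X. f v = t})"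
  define h where "h S = (f ` S, restrict (inv_into S f) (f ` S))" for S
  have fin: "finite ?\<I>" "finite (?P I)" if "I \<in> ?\<I>" for I
    using that assms(1,2) by (auto intro!: finite_PiE intro: finite_subset)
  have finI: "finite ?\<I>" using assms(2) by simp
  have "inj_on h ?\<S>"
  proof (rule inj_onI)
    fix S S' assume S: "S \<in> ?\<S>" "S' \<in> ?\<S>" "h S = h S'"
    have R: "snd (h R) ` fst (h R) = R" if "R \<in> ?\<S>" for R
      using that by (auto simp: h_def image_image)
    show "S = S'"
      using R[OF S(1)] R[OF S(2)] unfolding S(3) by (rule trans[OF sym])
  qed
  moreover have "h ` ?\<S> \<subseteq> Sigma ?\<I> ?P"
    using assms(3) by (auto simp: h_def card_image)
  moreover have "finite (Sigma ?\<I> ?P)"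
    using fin finI by (intro finite_SigmaI) auto
  ultimately have "card ?\<S> \<le> card (Sigma ?\<I> ?P)"
    by (rule card_inj_on_le)
  also have "\<dots> = (\<Sum>I\<in>?\<I>. card (?P I))"
    using fin finI by (intro card_SigmaI) auto
  also have "\<dots> = (\<Sum>I\<in>?\<I>. \<Prod>t\<in>I. card {v \<in> X. f v = t})"
    using assms(2) by (intro sum.cong refl card_PiE) (auto intro: finite_subset)
  finally show ?thesis .
qed

text \<open>
  The number of subsets is bounded by an elementary symmetric polynomial of the fibre sizes \<open>a t\<close>,
  which is a coefficient of \<open>\<Prod>t\<in>T. 1 + a t * x\<close>; evaluating at \<open>x = n / card X\<close> suffices.
\<close>

lemma card_inj_subsets_le:
  assumes "finite X" "X \<noteq> {}" "finite T" "f ` X \<subseteq> T" "n > 0"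
  shows "real (card {S. S \<subseteq> X \<and> card S = n \<and> inj_on f S})
    \<le> (card X / n) ^ n * (1 + n / card T) ^ card T"
proof -
  define a where "a t = card {v \<in> X. f v = t}" for t
  define x where "x = real n / card X"
  have M: "card X > 0" and N: "card T > 0"
    using assms by (auto simp: card_gt_0_iff)
  have x: "x > 0" using M assms(5) by (simp add: x_def)
  have "card X = (\<Sum>t\<in>T. a t)"
    unfolding a_def using sum.group[OF assms(1,3,4), of "\<lambda>_. 1::nat"] by simp
  then have sa: "(\<Sum>t\<in>T. real (a t)) = card X"
    by simp
  have "real (card {S. S \<subseteq> X \<and> card S = n \<and> inj_on f S})
      \<le> real (\<Sum>I | I \<subseteq> T \<and> card I = n. \<Prod>t\<in>I. a t)"
    unfolding a_def using card_inj_subsets_le_sum_prod[OF assms(1,3,4)] by (simp only: of_nat_le_iff)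
  also have "\<dots> = (\<Sum>I | I \<subseteq> T \<and> card I = n. \<Prod>t\<in>I. a t * x) / x ^ n"
    using x by (simp add: prod.distrib sum_divide_distrib)
  also have "(\<Sum>I | I \<subseteq> T \<and> card I = n. \<Prod>t\<in>I. a t * x) \<le> (\<Sum>I\<in>Pow T. \<Prod>t\<in>I. a t * x)"
    using assms(3) x by (intro sum_mono2) (auto intro!: prod_nonneg)
  also have "(\<Sum>I\<in>Pow T. \<Prod>t\<in>I. a t * x) = (\<Prod>t\<in>T. 1 + a t * x)"
    using prod_add[OF assms(3), of "\<lambda>t. a t * x" "\<lambda>_. 1"] by (simp add: add.commute)
  also have "\<dots> \<le> (1 + real n / card T) ^ card T"
  proof (rule prod_one_plus_le[OF assms(3)])
    show "(\<Sum>t\<in>T. a t * x) = card T * (real n / card T)"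
      using M N unfolding sum_distrib_right[symmetric] sa x_def by simp
  qed (use x in auto)
  finally have "real (card {S. S \<subseteq> X \<and> card S = n \<and> inj_on f S})
      \<le> (1 + real n / card T) ^ card T / x ^ n"
    using x by (meson divide_right_mono less_imp_le zero_less_power)
  also have "\<dots> = (card X / n) ^ n * (1 + n / card T) ^ card T"
    by (simp add: x_def power_divide)
  finally show ?thesis .
qed

section \<open>Elementary estimates\<close>

text \<open>The induction step amounts to
  \<open>exp 1 * n ^ (n + 1) \<le> (n + 1) ^ (n + 1)\<close>, which is
  \<open>1 - 1 / (n + 1) \<le> exp (- 1 / (n + 1))\<close> raised to the power
  \<open>n + 1\<close>.\<close>

lemma fact_le_stirling:
  assumes "n > 0"
  shows "fact n \<le> exp 1 * real n * (n / exp 1) ^ n"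
  using assms
proof (induction n rule: nat_induct_non_zero)
  case 1
  then show ?case by simp
next
  case (Suc n)
  have "real n / (n + 1) = 1 + (- 1 / (n + 1))"
    by (simp add: field_simps)
  also have "\<dots> \<le> exp (- 1 / (n + 1))"
    by (rule exp_ge_add_one_self)
  finally have "(real n / (n + 1)) ^ (n + 1) \<le> exp (- 1 / (n + 1)) ^ (n + 1)"
    by (intro power_mono) auto
  also have "\<dots> = exp (real (n + 1) * (- 1 / (n + 1)))"
    by (rule exp_of_nat_mult[symmetric])
  also have "real (n + 1) * (- 1 / (n + 1)) = -1"
    by simp
  finally have *: "exp 1 * real n ^ (n + 1) \<le> (real n + 1) ^ (n + 1)"
    by (simp add: power_divide exp_minus field_simps del: power_Suc)
  have "fact (Suc n) \<le> (real n + 1) * (exp 1 * real n * (n / exp 1) ^ n)"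
    unfolding fact_Suc of_nat_mult of_nat_Suc using Suc.IH by (intro mult_mono) auto
  also have "\<dots> = (real n + 1) / exp 1 ^ n * (exp 1 * real n ^ (n + 1))"
    by (simp add: power_divide field_simps)
  also have "\<dots> \<le> (real n + 1) / exp 1 ^ n * (real n + 1) ^ (n + 1)"
    using * by (intro mult_left_mono) auto
  also have "\<dots> = exp 1 * real (Suc n) * (Suc n / exp 1) ^ Suc n"
    by (simp add: power_divide field_simps)
  finally show ?case .
qed

text \<open>The quadratic gain over \<open>1 + y \<le> exp y\<close> is the source of the birthday
  exponent: with \<open>y = n / N\<close>, the power \<open>N\<close> gives
  \<open>exp (n - n\<^sup>2 / (6 * N))\<close>. The constant 6 leaves room for a short proof on all
  of [0, 1].\<close>

lemma one_plus_le_exp_quadratic: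
  fixes y :: real
  assumes "0 \<le> y" "y \<le> 1"
  shows "1 + y \<le> exp (y - y\<^sup>2 / 6)"
proof -
  define z where "z = y - y\<^sup>2 / 6"
  have yy: "y\<^sup>2 \<le> y" using assms by (simp add: power2_eq_square mult_left_le)
  have z: "z \<ge> 5/6 * y" using yy by (simp add: z_def)
  then have "(5/6 * y)\<^sup>2 \<le> z\<^sup>2"
    using assms by (intro power_mono) auto
  then have z2: "25/36 * y\<^sup>2 \<le> z\<^sup>2"
    by (simp add: power_mult_distrib power_divide)
  \<comment> \<open>Half of 25/36 exceeds the 1/6 subtracted in \<open>z\<close>.\<close>
  from z2 have "z + z\<^sup>2 / 2 \<ge> y"
    using z_def zero_le_power2[of y] by linarith
  moreover have "0 \<le> z" using z assms by simp
  then have "1 + z + z\<^sup>2 / 2 \<le> exp z"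
    by (rule exp_lower_Taylor_quadratic)
  ultimately show ?thesis unfolding z_def by simp
qed

text \<open>Each factor of the falling factorial is at least \<open>M - n\<close>, and Bernoulli
  gives \<open>(1 - n / M) ^ n \<ge> 1 - n\<^sup>2 / M \<ge> 1 / 2\<close>.\<close>

lemma binomial_ge_half_power_div_fact:
  assumes "2 * n\<^sup>2 \<le> M"
  shows "real M ^ n / (2 * fact n) \<le> real (M choose n)"
proof (cases "M = 0")
  case True
  then show ?thesis using assms by simp
next
  case False
  have nM: "n \<le> M" using assms by (metis le_square le_trans mult_2 power2_eq_square le_add1)
  have "real (2 * n\<^sup>2) \<le> real M" using assms by (simp only: of_nat_le_iff)
  then have "1 / 2 \<le> 1 + real n * (- (n / M))"
    using False by (simp add: field_simps power2_eq_square)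
  also have "\<dots> \<le> (1 + - (n / M)) ^ n"
    using nM False by (intro Bernoulli_inequality) (simp add: field_simps)
  finally have "real M ^ n * (1 / 2) \<le> real M ^ n * (1 + - (n / M)) ^ n"
    by (rule mult_left_mono) simp
  then have "real M ^ n / 2 \<le> real M ^ n * (1 - n / M) ^ n"
    by simp
  also have "\<dots> = (\<Prod>i = 0..<n. real M - n)"
    using False by (simp add: power_mult_distrib[symmetric] field_simps)
  also have "\<dots> \<le> (\<Prod>i = 0..<n. real M - i)"
    using nM by (intro prod_mono) auto
  also have "\<dots> = real (M choose n) * fact n"
    by (simp add: binomial_gbinomial gbinomial_prod_rev)
  finally show ?thesis by (simp add: field_simps)
qed

section \<open>Union bound over all labelings\<close>

text \<open>The sums lie in \<open>{..m * k}\<close>, a set of size \<open>N\<close>. In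
  \<open>large\<close>, \<open>(k + 1) ^ m\<close> counts the labelings, 2 is lost in the binomial
  bound and \<open>exp 1 * n\<close> in replacing \<open>fact n\<close> by
  \<open>(n / exp 1) ^ n\<close>. The condition \<open>n \<le> N\<close> allows the quadratic
  estimate at \<open>n / N\<close>.\<close>

lemma exists_subset_without_injective_labeling:
  fixes n m k :: nat
  defines "N \<equiv> m * k + 1"
  assumes n: "0 < n" "2 * n\<^sup>2 \<le> 2 ^ m" "n \<le> N"
    and large: "(k + 1) ^ m * (2 * exp 1 * n) < exp (real n ^ 2 / (6 * N))"
  obtains S where "S \<subseteq> Pow {..<m}" "card S = n"
    "\<And>l :: nat \<Rightarrow> nat. (\<And>i. i < m \<Longrightarrow> l i \<le> k) \<Longrightarrow> \<not> inj_on (\<lambda>v. \<Sum>i\<in>v. l i) S"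
proof -
  define \<S> where "\<S> = {S. S \<subseteq> Pow {..<m} \<and> card S = n}"
  \<comment> \<open>Label 0 is allowed, hence \<open>k + 1\<close> choices per index: indices that
    repeat an edge will later receive 0.\<close>
  define \<L> where "\<L> = PiE {..<m} (\<lambda>_. {..k})"
  define B where "B l = {S. S \<subseteq> Pow {..<m} \<and> card S = n \<and> inj_on (\<lambda>v. \<Sum>i\<in>v. l i) S}"
    for l :: "nat \<Rightarrow> nat"
  have fin: "finite \<L>" by (simp add: \<L>_def finite_PiE)
  have "card \<L> = (k + 1) ^ m" by (simp add: \<L>_def card_PiE)
  have B: "real (card (B l)) \<le> (2 ^ m / n) ^ n * (1 + n / N) ^ N" if "l \<in> \<L>" for l
  proof -
    have "(\<Sum>i\<in>v. l i) \<le> m * k" if "v \<in> Pow {..<m}" for v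
    proof -
      have "(\<Sum>i\<in>v. l i) \<le> of_nat (card v) * k"
        using that \<open>l \<in> \<L>\<close> by (intro sum_bounded_above) (auto simp: \<L>_def PiE_iff)
      also have "\<dots> \<le> m * k"
        using that card_mono[of "{..<m}" v] by simp
      finally show ?thesis .
    qed
    then show ?thesis
      using card_inj_subsets_le[of "Pow {..<m}" "{..m * k}" "\<lambda>v. \<Sum>i\<in>v. l i" n] n(1)
      by (auto simp: B_def N_def card_Pow image_subset_iff)
  qed
  have y: "(1 + n / N) ^ N \<le> exp n / exp (real n ^ 2 / (6 * N))"
  proof -
    have N: "N > 0" by (simp add: N_def)
    have "(1 + n / N) ^ N \<le> exp (n / N - (n / N)\<^sup>2 / 6) ^ N"
      using n(3) N by (intro power_mono one_plus_le_exp_quadratic) auto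
    also have "\<dots> = exp (n - real n ^ 2 / (6 * N))"
      using N by (simp add: exp_of_nat_mult[symmetric] field_simps power2_eq_square)
    finally show ?thesis by (simp add: exp_diff)
  qed
  have "real (card (\<Union>l\<in>\<L>. B l)) \<le> (\<Sum>l\<in>\<L>. real (card (B l)))"
    using card_UN_le[OF fin, of B] by (metis of_nat_le_iff of_nat_sum)
  also have "\<dots> \<le> (\<Sum>l\<in>\<L>. (2 ^ m / n) ^ n * (1 + n / N) ^ N)"
    by (intro sum_mono B)
  also have "\<dots> = (k + 1) ^ m * (2 ^ m / n) ^ n * (1 + n / N) ^ N"
    using \<open>card \<L> = _\<close> by simp
  also have "\<dots> \<le> (k + 1) ^ m * (2 ^ m / n) ^ n * (exp n / exp (real n ^ 2 / (6 * N)))"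
    using y by (intro mult_left_mono) auto
  also have "\<dots> = (2 ^ m / n) ^ n * exp n * ((k + 1) ^ m / exp (real n ^ 2 / (6 * N)))"
    by simp
  also have "\<dots> < (2 ^ m / n) ^ n * exp n * (1 / (2 * exp 1 * n))"
    using n(1) large by (intro mult_strict_left_mono) (auto simp: field_simps)
  also have "\<dots> = (2 ^ m) ^ n / (2 * (exp 1 * real n * (n / exp 1) ^ n))"
    using n(1) by (simp add: power_divide exp_of_nat_mult[symmetric])
  also have "\<dots> \<le> (2 ^ m) ^ n / (2 * fact n)"
    using fact_le_stirling[OF n(1)] n(1) by (intro divide_left_mono) (auto intro!: mult_pos_pos)
  also have "\<dots> \<le> card \<S>"
    using binomial_ge_half_power_div_fact[OF n(2)] by (simp add: \<S>_def n_subsets card_Pow)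
  finally have "card (\<Union>l\<in>\<L>. B l) < card \<S>" by simp
  moreover have "finite (\<Union>l\<in>\<L>. B l)"
    by (rule finite_subset[of _ "Pow (Pow {..<m})"]) (auto simp: B_def)
  ultimately obtain S where S: "S \<in> \<S>" "S \<notin> (\<Union>l\<in>\<L>. B l)"
    by (meson card_mono not_less subsetI)
  show thesis
  proof (rule that[of S])
    show SX: "S \<subseteq> Pow {..<m}" and "card S = n" using S by (auto simp: \<S>_def)
    fix l :: "nat \<Rightarrow> nat" assume l: "\<And>i. i < m \<Longrightarrow> l i \<le> k"
    \<comment> \<open>Only extensional functions belong to \<open>\<L>\<close>; restricting
      \<open>l\<close> leaves the sums over subsets of \<open>{..<m}\<close> unchanged.\<close>
    define l' where "l' = restrict l {..<m}"
    have "l' \<in> \<L>" using l by (auto simp: \<L>_def l'_def)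
    then have "\<not> inj_on (\<lambda>v. \<Sum>i\<in>v. l' i) S"
      using S by (auto simp: B_def \<S>_def)
    moreover have "inj_on (\<lambda>v. \<Sum>i\<in>v. l' i) S \<longleftrightarrow> inj_on (\<lambda>v. \<Sum>i\<in>v. l i) S"
      using SX by (intro inj_on_cong sum.cong refl) (auto simp: l'_def)
    ultimately show "\<not> inj_on (\<lambda>v. \<Sum>i\<in>v. l i) S"
      by blast
  qed
qed

section \<open>From labels of indices to irregular labelings\<close>

text \<open>Labeling the edges by distinct powers of two makes a vertex sum the binary code of the
  set of edges at that vertex, and separated vertices have different such sets.\<close>

lemma irregular_labeling_exists:
  assumes "finite E" "\<And>x y. x \<in> V \<Longrightarrow> y \<in> V \<Longrightarrow> x \<noteq> y \<Longrightarrow> \<exists>e\<in>E. (x \<in> e) \<noteq> (y \<in> e)"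
  shows "\<exists>g. irregular_labeling V E g"
proof -
  obtain r where r: "inj_on r E" "r ` E \<subseteq> (UNIV :: nat set)"
    using finite_imp_inj_to_nat_seg[OF assms(1)] by auto
  define g where "g e = (2::nat) ^ r e" for e
  have "vertex_sum E g x = set_encode (r ` {e \<in> E. x \<in> e})" for x
    unfolding vertex_sum_def set_encode_def g_def
    by (subst sum.reindex) (auto intro: inj_on_subset[OF r(1)])
  then have "inj_on (vertex_sum E g) V"
  proof (intro inj_onI)
    fix x y assume V: "x \<in> V" "y \<in> V" and "vertex_sum E g x = vertex_sum E g y"
      and sum: "\<And>x. vertex_sum E g x = set_encode (r ` {e \<in> E. x \<in> e})"
    then have "r ` {e \<in> E. x \<in> e} = r ` {e \<in> E. y \<in> e}"
      using assms(1) by (simp add: set_encode_eq)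
    then have "{e \<in> E. x \<in> e} = {e \<in> E. y \<in> e}"
      using inj_on_image_eq_iff[OF r(1)] by (metis (no_types, lifting) mem_Collect_eq subsetI)
    then show "x = y" using assms(2)[OF V] by blast
  qed
  then have "irregular_labeling V E g"
    by (simp add: irregular_labeling_def g_def)
  then show ?thesis by blast
qed

lemma irr_attained:
  assumes "irregular_labeling V E g"
  obtains h where "irregular_labeling V E h" "largest_label E h = irr V E"
proof -
  have "\<exists>h. irregular_labeling V E h \<and> irr V E = largest_label E h"
    unfolding irr_def by (rule LeastI_ex) (use assms in blast)
  then show ?thesis
    using that by auto
qed

lemma label_le_largest_label:
  assumes "finite E" "e \<in> E"
  shows "g e \<le> largest_label E g"
  unfolding largest_label_def using assms by (intro Max_ge) auto

text \<open>
  Different \<open>i\<close> may give the same edge \<open>{v \<in> S. i \<in> v}\<close>: one representative carries its label, the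
  others get 0.
\<close>

lemma vertex_sum_eq_sum_labels:
  fixes S :: "nat set set"
  assumes S: "S \<subseteq> Pow {..<m}"
  obtains l where "\<And>i. l i \<le> largest_label ((\<lambda>i. {v \<in> S. i \<in> v}) ` {..<m}) g"
    "\<And>v. v \<in> S \<Longrightarrow> (\<Sum>i\<in>v. l i) = vertex_sum ((\<lambda>i. {v \<in> S. i \<in> v}) ` {..<m}) g v"
proof -
  define edge where "edge i = {v \<in> S. i \<in> v}" for i
  obtain R where R: "R \<subseteq> {..<m}" "inj_on edge R" "edge ` R = edge ` {..<m}"
    by (metis subset_image_inj order_refl)
  define l where "l i = (if i \<in> R then g (edge i) else 0)" for i
  have "l i \<le> largest_label (edge ` {..<m}) g" for i
    using R(1) by (auto simp: l_def intro!: label_le_largest_label)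
  moreover have "(\<Sum>i\<in>v. l i) = vertex_sum (edge ` {..<m}) g v" if "v \<in> S" for v
  proof -
    have finv: "finite v" using that S by (meson PowD finite_lessThan finite_subset subsetD)
    have "{e \<in> edge ` {..<m}. v \<in> e} = edge ` (v \<inter> R)"
      unfolding R(3)[symmetric] using that by (auto simp: edge_def)
    then have "vertex_sum (edge ` {..<m}) g v = (\<Sum>i\<in>v \<inter> R. g (edge i))"
      unfolding vertex_sum_def by (simp add: sum.reindex inj_on_subset[OF R(2)])
    also have "\<dots> = (\<Sum>i\<in>v. l i)"
      using finv by (simp add: l_def sum.inter_restrict)
    finally show ?thesis by simp
  qed
  ultimately show ?thesis
    by (intro that[folded edge_def])
qed

text \<open>An optimal irregular labeling of the hypergraph on \<open>S\<close> would, if its labels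
  were at most \<open>k\<close>, turn into labels of the indices with injective sums, contradicting
  \<open>noninj\<close>.\<close>

lemma irr_max_gt:
  fixes S :: "nat set set"
  assumes S: "S \<subseteq> Pow {..<m}"
    and noninj: "\<And>l :: nat \<Rightarrow> nat. (\<And>i. i < m \<Longrightarrow> l i \<le> k) \<Longrightarrow> \<not> inj_on (\<lambda>v. \<Sum>i\<in>v. l i) S"
  shows "k < irr_max (card S)"
proof -
  define E where "E = (\<lambda>i. {v \<in> S. i \<in> v}) ` {..<m}"
  have "finite S" using S by (rule finite_subset) simp
  then have hyp: "hypergraph S E"
    by (auto simp: hypergraph_def E_def)
  have "finite E" by (simp add: E_def)
  have "\<exists>e\<in>E. (x \<in> e) \<noteq> (y \<in> e)" if "x \<in> S" "y \<in> S" "x \<noteq> y" for x y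
  proof -
    \<comment> \<open>Distinct subsets differ in some index, and the edge of that index separates
      them, so an irregular labeling exists.\<close>
    obtain i where "i \<in> x \<longleftrightarrow> i \<notin> y" using \<open>x \<noteq> y\<close> by blast
    then have "i < m" "(x \<in> {v \<in> S. i \<in> v}) \<noteq> (y \<in> {v \<in> S. i \<in> v})"
      using that S by auto
    then show ?thesis by (auto simp: E_def)
  qed
  then obtain g0 where g0: "irregular_labeling S E g0"
    using irregular_labeling_exists[of E S] \<open>finite E\<close> by metis
  then obtain g where g: "irregular_labeling S E g" "largest_label E g = irr S E"
    by (rule irr_attained)
  obtain l where l: "\<And>i. l i \<le> largest_label E g"
      "\<And>v. v \<in> S \<Longrightarrow> (\<Sum>i\<in>v. l i) = vertex_sum E g v"
    by (rule vertex_sum_eq_sum_labels[OF S, of g, folded E_def]) (rule that)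
  have "inj_on (\<lambda>v. \<Sum>i\<in>v. l i) S \<longleftrightarrow> inj_on (vertex_sum E g) S"
    by (rule inj_on_cong) (rule l(2))
  then have "inj_on (\<lambda>v. \<Sum>i\<in>v. l i) S"
    using g(1) by (simp add: irregular_labeling_def)
  then have "\<not> (\<forall>i<m. l i \<le> k)"
    using noninj[of l] by blast
  then obtain i where "k < l i"
    by (auto simp: not_le)
  also have "l i \<le> irr S E"
    using l(1)[of i] g(2) by simp
  \<comment> \<open>The vertices are sets of naturals, whereas \<open>irr_max\<close> ranges over
    vertices in \<open>nat\<close>; \<open>irr_le_irr_max\<close> covers any vertex type.\<close>
  also have "\<dots> \<le> irr_max (card S)"
    by (rule irr_le_irr_max[OF hyp g0])
  finally show ?thesis .
qed

section \<open>Choice of parameters and asymptotics\<close>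

theorem theorem5:
  fixes \<epsilon> :: real
  assumes "\<epsilon> > 0"
  shows "\<exists>n0 :: nat. \<forall>n > n0. real (irr_max n) \<ge> real n powr (2 - \<epsilon>)"
proof -
  \<comment> \<open>A smaller exponent loss only strengthens the bound, and the cap 1/2 keeps
    \<open>n powr (2 - \<delta>)\<close> above \<open>n + 1\<close>, so that
    \<open>n \<le> k\<close>.\<close>
  define \<delta> where "\<delta> = min \<epsilon> (1 / 2)"
  have \<delta>: "0 < \<delta>" "\<delta> \<le> 1 / 2" "\<delta> \<le> \<epsilon>" using assms by (auto simp: \<delta>_def)
  \<comment> \<open>Chosen so that \<open>2 powr (c * ln n) = n ^ 4\<close>, which leaves room for
    \<open>2 * n\<^sup>2 \<le> 2 ^ m\<close>.\<close>
  define c where "c = 4 / ln (2 :: real)"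
  have c: "0 < c" by (simp add: c_def)
  have ev1: "\<forall>\<^sub>F n :: nat in sequentially. 2 * real n ^ 2 \<le> real n ^ 4"
    by real_asymp
  have ev2: "\<forall>\<^sub>F n :: nat in sequentially. real n + 1 \<le> real n powr (2 - \<delta>)"
    using \<delta> by real_asymp
  \<comment> \<open>The left side is \<open>exp\<close> of order \<open>(ln n)\<^sup>2\<close>, the
    right side \<open>exp\<close> of order \<open>n powr \<delta> / ln n\<close>.\<close>
  have ev3: "\<forall>\<^sub>F n :: nat in sequentially.
      (real n powr (2 - \<delta>) + 1) powr (c * ln n + 1) * (2 * exp 1 * real n)
        < exp (real n ^ 2 / (6 * ((c * ln n + 1) * real n powr (2 - \<delta>) + 1)))"
    using \<delta> c by real_asymp
  have "\<forall>\<^sub>F n in sequentially. real n powr (2 - \<epsilon>) \<le> irr_max n"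
    using ev1 ev2 ev3 eventually_gt_at_top[of 1]
  proof eventually_elim
    case (elim n)
    define m where "m = nat \<lceil>c * ln n\<rceil>"
    define k where "k = nat \<lfloor>real n powr (2 - \<delta>)\<rfloor>"
    have ln: "0 < c * ln n" using elim c by simp
    have m: "c * ln n \<le> m" "m \<le> c * ln n + 1" "0 < m"
      using ln unfolding m_def by linarith+
    have k: "k \<le> real n powr (2 - \<delta>)" "real n powr (2 - \<delta>) < k + 1"
      unfolding k_def by (simp, linarith)
    have "real n ^ 4 = 2 powr (c * ln n)"
      using elim(4) by (simp add: c_def powr_def exp_of_nat_mult[of 4, simplified])
    also have "\<dots> \<le> 2 powr m"
      using m(1) by (intro powr_mono) auto
    finally have "2 * real n ^ 2 \<le> 2 powr m"
      using elim(1) by linarith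
    then have "real (2 * n\<^sup>2) \<le> real (2 ^ m)" by (simp add: powr_realpow)
    then have m2: "2 * n\<^sup>2 \<le> 2 ^ m" by (simp only: of_nat_le_iff)
    have "n \<le> k" using elim(2) k(2) by linarith
    also have "k \<le> m * k + 1" using m(3) by (simp add: le_Suc_eq trans_le_add1)
    finally have nN: "n \<le> m * k + 1" .
    have mk: "real (m * k + 1) \<le> (c * ln n + 1) * real n powr (2 - \<delta>) + 1"
      using m k(1) ln by (auto intro!: mult_mono)
    have "(real k + 1) ^ m = (real k + 1) powr m"
      by (simp add: powr_realpow)
    also have "\<dots> \<le> (real n powr (2 - \<delta>) + 1) powr m"
      using k(1) by (intro powr_mono2) auto
    also have "\<dots> \<le> (real n powr (2 - \<delta>) + 1) powr (c * ln n + 1)"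
      using m(2) by (intro powr_mono) auto
    finally have "(real k + 1) ^ m * (2 * exp 1 * n)
        \<le> (real n powr (2 - \<delta>) + 1) powr (c * ln n + 1) * (2 * exp 1 * n)"
      by (intro mult_right_mono) auto
    also have "\<dots> < exp (real n ^ 2 / (6 * ((c * ln n + 1) * real n powr (2 - \<delta>) + 1)))"
      by (rule elim(3))
    also have "\<dots> \<le> exp (real n ^ 2 / (6 * real (m * k + 1)))"
      unfolding exp_le_cancel_iff using mk ln
      by (intro divide_left_mono) (auto intro!: mult_pos_pos add_nonneg_pos simp del: of_nat_add of_nat_mult)
    finally have "(real k + 1) ^ m * (2 * exp 1 * n) < exp (real n ^ 2 / (6 * real (m * k + 1)))" .
    then obtain S where S: "S \<subseteq> Pow {..<m}" "card S = n"
      "\<And>l :: nat \<Rightarrow> nat. (\<And>i. i < m \<Longrightarrow> l i \<le> k) \<Longrightarrow> \<not> inj_on (\<lambda>v. \<Sum>i\<in>v. l i) S"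
      using exists_subset_without_injective_labeling[of n m k] m2 nN elim(4)
      by (auto simp: add.commute)
    have "real n powr (2 - \<epsilon>) \<le> real n powr (2 - \<delta>)"
      using \<delta> elim(4) by (intro powr_mono) auto
    \<comment> \<open>The strict inequality \<open>k < irr_max n\<close> makes up for rounding down
      in \<open>k\<close>.\<close>
    also have "\<dots> \<le> real (k + 1)" using k(2) by simp
    also have "\<dots> \<le> irr_max n"
    proof -
      have "k < irr_max (card S)"
        by (rule irr_max_gt[OF S(1)]) (rule S(3))
      then show ?thesis using S(2) by simp
    qed
    finally show ?case .
  qed
  then obtain n0 where "\<forall>n\<ge>n0. real n powr (2 - \<epsilon>) \<le> irr_max n"
    by (auto simp: eventually_sequentially)
  then show ?thesis by (intro exI[of _ n0]) auto
qed

end
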